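(* Let $\beta>0$ with $\beta^{-1}\in\mathbb{N}$ and $\beta^{-1}\ge 3$. There exists no function $\phi\in L^2(\mathbb{R})$ with either $\hat\phi$ compactly supported, or $\phi$ and $\hat\phi$ both having exponential decay, such that the Wilson system $\mathcal{W}(\phi,1,\beta)$ is an orthonormal basis for $L^2(\mathbb{R})$.
   Context: The Fourier transform is $\hat f(w)=\int_{\mathbb{R}} f(t)e^{-2\pi i t w}\,dt$ (extended unitarily to $L^2(\mathbb{R})$). $\mathbb{N}=\{1,2,\dots\}$, $\mathbb{N}_0=\mathbb{N}\cup\{0\}$. A function $h$ has exponential decay if $|h(x)|\le Ce^{-\lambda|x|}$ for all $x \in \mathbb{R}$, for some constants $C,\lambda>0$. For $\phi\in L^2(\mathbb{R})$ and $\alpha,\beta>0$, put $\phi_{j,m}(x)=\phi(x-\beta j)e^{2\pi i\alpha m x}$ for $j,m\in\mathbb{Z}$. The (bimodal) Wilson system is $\mathcal{W}(\phi,\alpha,\beta)=\{\psi_{j,m}: j\in\mathbb{Z}, m\in\mathbb{N}_0\}$ with $$\psi_{j,0}(x)=\sqrt{2\beta}\,\phi_{2j,0}(x)=\sqrt{2\beta}\,\phi(x-2\beta j)\quad (j\in\mathbb{Z}),$$ $$\psi_{j,m}(x)=\sqrt{\beta}\left[e^{-2\pi i\beta j\alpha m}\phi_{j,m}(x)+(-1)^{j+m}e^{2\pi i\beta j\alpha m}\phi_{j,-m}(x)\right]\quad (j\in\mathbb{Z},\ m\in\mathbb{N}).$$ *)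

theory Defs
  imports "HOL-Analysis.Analysis"
begin

text \<open>
  Elements of \<open>L\<^sup>2(\<real>)\<close> are handled through Borel representatives; every class of Lebesgue
  measurable functions contains one. Equality in \<open>L\<^sup>2(\<real>)\<close> is equality almost everywhere.
\<close>

definition L2 :: "(real \<Rightarrow> complex) set" where
  "L2 = {f \<in> borel_measurable lborel. integrable lborel (\<lambda>x. (cmod (f x))\<^sup>2)}"

definition L2_inner :: "(real \<Rightarrow> complex) \<Rightarrow> (real \<Rightarrow> complex) \<Rightarrow> complex" where
  "L2_inner f g = (LINT x|lborel. f x * cnj (g x))"

definition L2_norm :: "(real \<Rightarrow> complex) \<Rightarrow> real" where
  "L2_norm f = sqrt (LINT x|lborel. (cmod (f x))\<^sup>2)"

definition fourier :: "(real \<Rightarrow> complex) \<Rightarrow> real \<Rightarrow> complex" where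
  "fourier f w = (LINT t|lborel. f t * cis (- (2 * pi * t * w)))"

text \<open>
  \<open>fourier_L2 f g\<close>: the function \<open>g\<close> represents the Fourier transform of \<open>f \<in> L\<^sup>2(\<real>)\<close>, where the
  transform is extended by continuity from \<open>L\<^sup>1 \<inter> L\<^sup>2\<close>. Being a relation, it leaves the choice of
  \<open>g\<close> on null sets free. By Plancherel's theorem the condition \<open>fourier (s n) \<in> L2\<close> is automatic; it
  is listed because the integral in \<open>L2_norm\<close> is 0 for non-integrable integrands.
\<close>

definition fourier_L2 :: "(real \<Rightarrow> complex) \<Rightarrow> (real \<Rightarrow> complex) \<Rightarrow> bool" where
  "fourier_L2 f g \<longleftrightarrow> f \<in> L2 \<and> g \<in> L2 \<and>
     (\<exists>s :: nat \<Rightarrow> real \<Rightarrow> complex.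
        (\<forall>n. integrable lborel (s n) \<and> s n \<in> L2 \<and> fourier (s n) \<in> L2) \<and>
        (\<lambda>n. L2_norm (\<lambda>t. s n t - f t)) \<longlonglongrightarrow> 0 \<and>
        (\<lambda>n. L2_norm (\<lambda>w. fourier (s n) w - g w)) \<longlonglongrightarrow> 0)"

definition compactly_supported :: "(real \<Rightarrow> complex) \<Rightarrow> bool" where
  "compactly_supported h \<longleftrightarrow> compact (closure {x. h x \<noteq> 0})"

definition exponential_decay :: "(real \<Rightarrow> complex) \<Rightarrow> bool" where
  "exponential_decay h \<longleftrightarrow> (\<exists>C>0. \<exists>l>0. \<forall>x. cmod (h x) \<le> C * exp (- l * \<bar>x\<bar>))"

text \<open>
  Orthonormal basis, for indexed families: orthonormality refers to indices (no repetitions), and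
  the finite linear combinations are dense.
\<close>

definition orthonormal_basis_L2 :: "('i \<Rightarrow> real \<Rightarrow> complex) \<Rightarrow> bool" where
  "orthonormal_basis_L2 e \<longleftrightarrow>
     (\<forall>i. e i \<in> L2) \<and>
     (\<forall>i k. L2_inner (e i) (e k) = (if i = k then 1 else 0)) \<and>
     (\<forall>f\<in>L2. \<forall>\<epsilon>>0. \<exists>I c. finite I \<and> L2_norm (\<lambda>x. f x - (\<Sum>i\<in>I. c i * e i x)) < \<epsilon>)"

definition tf_shift :: "(real \<Rightarrow> complex) \<Rightarrow> real \<Rightarrow> real \<Rightarrow> int \<Rightarrow> int \<Rightarrow> real \<Rightarrow> complex" where
  "tf_shift \<phi> \<alpha> \<beta> j m x = \<phi> (x - \<beta> * of_int j) * cis (2 * pi * \<alpha> * of_int m * x)"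

definition wilson_system ::
    "(real \<Rightarrow> complex) \<Rightarrow> real \<Rightarrow> real \<Rightarrow> int \<times> nat \<Rightarrow> real \<Rightarrow> complex" where
  "wilson_system \<phi> \<alpha> \<beta> = (\<lambda>(j, m) x.
     if m = 0 then of_real (sqrt (2 * \<beta>)) * tf_shift \<phi> \<alpha> \<beta> (2 * j) 0 x
     else of_real (sqrt \<beta>) *
       (cis (- (2 * pi * \<beta> * of_int j * \<alpha> * of_nat m)) * tf_shift \<phi> \<alpha> \<beta> j (int m) x +
        (- 1) powi (j + int m) *
          cis (2 * pi * \<beta> * of_int j * \<alpha> * of_nat m) * tf_shift \<phi> \<alpha> \<beta> j (- int m) x))"

end

theory Submission
  imports Defs
begin

text \<open>
  The obstruction is one of density. Write \<open>\<beta> = 1/N\<close>. The functions \<open>gab (n, k)\<close>, that is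
  \<open>cis (2\<pi>kx)\<close> restricted to \<open>[n, n + 1)\<close>, form an orthonormal basis of \<open>L\<^sup>2(\<real>)\<close> that is
  permuted by integer translations and modulations. Hence a single \<open>K\<close> suffices to approximate all
  \<open>\<psi>\<^sub>j\<^sub>,\<^sub>m\<close> with \<open>0 \<le> j < N M\<close>, \<open>1 \<le> m \<le> M\<close> up to a small fixed error from the span of the
  \<open>gab (n, k)\<close> with \<open>-K \<le> n \<le> M + K\<close>, \<open>\<bar>k\<bar> \<le> M + K\<close>. If the \<open>\<psi>\<^sub>j\<^sub>,\<^sub>m\<close> are orthonormal,
  comparing the two cardinalities \<open>N M\<^sup>2\<close> and \<open>2 M\<^sup>2 + O(M)\<close> forces \<open>N \<le> 2\<close>.
\<close>

section \<open>Calculus of the squared norm and the inner product\<close>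

definition L2_sq :: "(real \<Rightarrow> complex) \<Rightarrow> real" where
  "L2_sq f = (LINT x|lborel. (cmod (f x))\<^sup>2)"

text \<open>The index set is explicit because the count compares finite subfamilies.\<close>

definition orthonormal_on :: "'i set \<Rightarrow> ('i \<Rightarrow> real \<Rightarrow> complex) \<Rightarrow> bool" where
  "orthonormal_on I e \<longleftrightarrow>
     (\<forall>i\<in>I. e i \<in> L2) \<and> (\<forall>i\<in>I. \<forall>k\<in>I. L2_inner (e i) (e k) = (if i = k then 1 else 0))"

lemma cmod_add_sq_le: "(cmod (a + b))\<^sup>2 \<le> 2 * (cmod a)\<^sup>2 + 2 * (cmod b)\<^sup>2"
proof -
  have "(cmod (a + b))\<^sup>2 \<le> (cmod a + cmod b)\<^sup>2"
    by (simp add: norm_triangle_ineq power_mono)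
  also have "\<dots> \<le> 2 * (cmod a)\<^sup>2 + 2 * (cmod b)\<^sup>2"
    using sum_squares_bound[of "cmod a" "cmod b"] by (simp add: power2_eq_square algebra_simps)
  finally show ?thesis .
qed

lemma L2_measurable [measurable_dest]: "f \<in> L2 \<Longrightarrow> f \<in> borel_measurable borel"
  by (simp add: L2_def)

lemma L2_integrable_sq: "f \<in> L2 \<Longrightarrow> integrable lborel (\<lambda>x. (cmod (f x))\<^sup>2)"
  by (simp add: L2_def)

lemma L2_scale: "f \<in> L2 \<Longrightarrow> (\<lambda>x. c * f x) \<in> L2"
  by (auto simp: L2_def norm_mult power_mult_distrib)

lemma L2_add:
  assumes "f \<in> L2" "g \<in> L2"
  shows "(\<lambda>x. f x + g x) \<in> L2"
proof -
  have [measurable]: "f \<in> borel_measurable borel" "g \<in> borel_measurable borel"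
    using assms by (auto simp: L2_def)
  have "integrable lborel (\<lambda>x. (cmod (f x + g x))\<^sup>2)"
  proof (rule Bochner_Integration.integrable_bound)
    show "integrable lborel (\<lambda>x. 2 * (cmod (f x))\<^sup>2 + 2 * (cmod (g x))\<^sup>2)"
      using assms by (auto simp: L2_def)
  qed (auto simp: cmod_add_sq_le)
  then show ?thesis by (simp add: L2_def)
qed

lemma L2_zero: "(\<lambda>x. 0) \<in> L2"
  by (simp add: L2_def)

lemma L2_sum: "(\<And>i. i \<in> I \<Longrightarrow> f i \<in> L2) \<Longrightarrow> (\<lambda>x. \<Sum>i\<in>I. f i x) \<in> L2"
  by (induction I rule: infinite_finite_induct) (auto simp: L2_zero L2_add)

lemma L2_diff: "f \<in> L2 \<Longrightarrow> g \<in> L2 \<Longrightarrow> (\<lambda>x. f x - g x) \<in> L2"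
  using L2_add[of f "\<lambda>x. -1 * g x"] L2_scale[of g "-1"] by simp

lemma L2_bound:
  assumes "g \<in> L2" "f \<in> borel_measurable borel" "\<And>x. cmod (f x) \<le> cmod (g x)"
  shows "f \<in> L2"
proof -
  have "integrable lborel (\<lambda>x. (cmod (f x))\<^sup>2)"
    by (rule Bochner_Integration.integrable_bound[OF L2_integrable_sq[OF assms(1)]])
       (use assms in \<open>auto intro!: power_mono\<close>)
  then show ?thesis using assms by (simp add: L2_def)
qed

lemma L2_sq_nonneg: "0 \<le> L2_sq f"
  by (simp add: L2_sq_def)

lemma L2_sq_mono:
  assumes "g \<in> L2" "f \<in> borel_measurable borel" "\<And>x. cmod (f x) \<le> cmod (g x)"
  shows "L2_sq f \<le> L2_sq g"
  unfolding L2_sq_def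
  by (intro integral_mono L2_integrable_sq L2_bound[OF assms] assms power_mono) auto

lemma L2_sq_scale: "L2_sq (\<lambda>x. c * f x) = (cmod c)\<^sup>2 * L2_sq f"
  by (simp add: L2_sq_def norm_mult power_mult_distrib)

text \<open>Stands in for the triangle inequality while avoiding square roots; its factors 2 account
  for the constants in the later error bounds.\<close>

lemma L2_sq_add_le:
  assumes "f \<in> L2" "g \<in> L2"
  shows "L2_sq (\<lambda>x. f x + g x) \<le> 2 * L2_sq f + 2 * L2_sq g"
proof -
  have "L2_sq (\<lambda>x. f x + g x) \<le> (LINT x|lborel. 2 * (cmod (f x))\<^sup>2 + 2 * (cmod (g x))\<^sup>2)"
    unfolding L2_sq_def
    by (intro integral_mono) (use assms L2_add[OF assms] in \<open>auto simp: L2_def cmod_add_sq_le\<close>)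
  also have "\<dots> = 2 * L2_sq f + 2 * L2_sq g"
    using assms by (simp add: L2_sq_def L2_def)
  finally show ?thesis .
qed

lemma L2_integrable_mult_cnj:
  assumes "f \<in> L2" "g \<in> L2"
  shows "integrable lborel (\<lambda>x. f x * cnj (g x))"
proof (rule Bochner_Integration.integrable_bound)
  show "integrable lborel (\<lambda>x. (cmod (f x))\<^sup>2 + (cmod (g x))\<^sup>2)"
    using assms by (auto simp: L2_def)
  have "cmod (f x * cnj (g x)) \<le> (cmod (f x))\<^sup>2 + (cmod (g x))\<^sup>2" for x
    using sum_squares_bound[of "cmod (f x)" "cmod (g x)"]
      mult_nonneg_nonneg[OF norm_ge_zero[of "f x"] norm_ge_zero[of "g x"]]
    by (simp add: norm_mult mult.assoc del: mult_nonneg_nonneg)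
  then show "AE x in lborel. norm (f x * cnj (g x)) \<le> norm ((cmod (f x))\<^sup>2 + (cmod (g x))\<^sup>2)"
    by auto
  have [measurable]: "f \<in> borel_measurable borel" "g \<in> borel_measurable borel"
    using assms by (auto simp: L2_def)
  show "(\<lambda>x. f x * cnj (g x)) \<in> borel_measurable lborel"
    by (intro borel_measurable_times) (auto intro: measurable_compose[OF _ borel_measurable_continuous_onI[of cnj]] continuous_intros)
qed

lemma L2_inner_diff_left:
  "f \<in> L2 \<Longrightarrow> g \<in> L2 \<Longrightarrow> h \<in> L2 \<Longrightarrow>
    L2_inner (\<lambda>x. f x - g x) h = L2_inner f h - L2_inner g h"
  unfolding L2_inner_def
  by (subst Bochner_Integration.integral_diff[symmetric]) (auto intro: L2_integrable_mult_cnj simp: algebra_simps)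

lemma L2_inner_sum_left:
  assumes "\<And>i. i \<in> I \<Longrightarrow> f i \<in> L2" "h \<in> L2"
  shows "L2_inner (\<lambda>x. \<Sum>i\<in>I. a i * f i x) h = (\<Sum>i\<in>I. a i * L2_inner (f i) h)"
proof -
  have "L2_inner (\<lambda>x. \<Sum>i\<in>I. a i * f i x) h = (LINT x|lborel. (\<Sum>i\<in>I. a i * (f i x * cnj (h x))))"
    by (simp add: L2_inner_def sum_distrib_right mult.assoc)
  also have "\<dots> = (\<Sum>i\<in>I. LINT x|lborel. a i * (f i x * cnj (h x)))"
    by (rule Bochner_Integration.integral_sum)
       (intro integrable_mult_right L2_integrable_mult_cnj assms)
  finally show ?thesis by (simp add: L2_inner_def)
qed

lemma L2_inner_commute: "L2_inner g f = cnj (L2_inner f g)"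
proof -
  have "cnj (L2_inner f g) = (LINT x|lborel. cnj (f x * cnj (g x)))"
    unfolding L2_inner_def by (rule Bochner_Integration.integral_cnj[symmetric])
  then show ?thesis by (simp add: L2_inner_def mult.commute)
qed

lemma L2_inner_self: "L2_inner f f = of_real (L2_sq f)"
  by (simp add: L2_inner_def L2_sq_def complex_norm_square[symmetric] flip: integral_complex_of_real)

section \<open>Finite orthonormal systems: Pythagoras, Bessel and comparison of
  cardinalities\<close>

lemma L2_sq_diff_unit:
  assumes f: "f \<in> L2" and v: "v \<in> L2" "L2_inner v v = 1"
  shows "L2_sq (\<lambda>x. f x - a * v x)
           = L2_sq f - (cmod (L2_inner f v))\<^sup>2 + (cmod (a - L2_inner f v))\<^sup>2"
proof -
  have sq: "(cmod (z - w))\<^sup>2 = (cmod z)\<^sup>2 - 2 * Re (z * cnj w) + (cmod w)\<^sup>2" for z w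
    unfolding cmod_power2 by (simp add: power2_eq_square algebra_simps)
  note int = L2_integrable_mult_cnj[OF f v(1)]
  have reI: "integrable lborel (\<lambda>x. Re (cnj a * (f x * cnj (v x))))"
    by (intro integrable_Re integrable_mult_right int)
  have re: "(LINT x|lborel. Re (cnj a * (f x * cnj (v x)))) = Re (cnj a * L2_inner f v)"
    unfolding L2_inner_def using int by (subst integral_Re) auto
  have v1: "L2_sq v = 1"
    using v(2) by (simp add: L2_inner_self)
  have "L2_sq (\<lambda>x. f x - a * v x)
      = (LINT x|lborel. (cmod (f x))\<^sup>2 - 2 * Re (cnj a * (f x * cnj (v x))) + (cmod a)\<^sup>2 * (cmod (v x))\<^sup>2)"
    unfolding L2_sq_def sq by (simp add: norm_mult power_mult_distrib mult_ac)
  also have "\<dots> = L2_sq f - 2 * Re (cnj a * L2_inner f v) + (cmod a)\<^sup>2 * L2_sq v"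
    unfolding L2_sq_def L2_inner_def
    using L2_integrable_sq[OF f] L2_integrable_sq[OF v(1)] re reI
    by (simp del: times_complex.sel add: L2_inner_def)
  \<comment> \<open>Completing the square in \<open>a\<close> around the coefficient
    \<open>L2_inner f v\<close>.\<close>
  also have "\<dots> = L2_sq f - (cmod (L2_inner f v))\<^sup>2 + (cmod (a - L2_inner f v))\<^sup>2"
    by (simp add: v1 sq)
  finally show ?thesis .
qed

text \<open>The coefficients stay arbitrary because two choices matter: the Fourier coefficients
  give Bessel's inequality, and the unknown coefficients of a good approximation give a lower bound
  for the projection.\<close>

lemma L2_sq_diff_orthonormal:
  assumes "finite J" "f \<in> L2" "orthonormal_on J v"
  shows "L2_sq (\<lambda>x. f x - (\<Sum>j\<in>J. a j * v j x))
     = L2_sq f - (\<Sum>j\<in>J. (cmod (L2_inner f (v j)))\<^sup>2) + (\<Sum>j\<in>J. (cmod (a j - L2_inner f (v j)))\<^sup>2)"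
  using assms
proof (induction J)
  case (insert i J)
  have v: "\<And>j. j \<in> insert i J \<Longrightarrow> v j \<in> L2"
    and o: "\<And>j k. j \<in> insert i J \<Longrightarrow> k \<in> insert i J \<Longrightarrow> L2_inner (v j) (v k) = (if j = k then 1 else 0)"
    using insert.prems(2) by (auto simp: orthonormal_on_def)
  let ?g = "\<lambda>x. f x - (\<Sum>j\<in>J. a j * v j x)"
  have S: "(\<lambda>x. \<Sum>j\<in>J. a j * v j x) \<in> L2"
    by (intro L2_sum L2_scale v) auto
  have g: "?g \<in> L2"
    by (intro L2_diff S insert.prems)
  \<comment> \<open>By orthogonality, subtracting the other components does not change the
    coefficient along \<open>v i\<close>, so the one-vector identity applies to the
    residual.\<close>
  have "L2_inner ?g (v i) = L2_inner f (v i) - (\<Sum>j\<in>J. a j * L2_inner (v j) (v i))"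
    using S v insert.prems(1) by (subst L2_inner_diff_left) (auto simp: L2_inner_sum_left)
  also have "(\<Sum>j\<in>J. a j * L2_inner (v j) (v i)) = 0"
    using insert.hyps by (intro sum.neutral) (auto simp: o)
  finally have gi: "L2_inner ?g (v i) = L2_inner f (v i)" by simp
  have "(\<lambda>x. f x - (\<Sum>j\<in>insert i J. a j * v j x)) = (\<lambda>x. ?g x - a i * v i x)"
    using insert.hyps by (auto simp: algebra_simps)
  moreover have "orthonormal_on J v"
    using insert.prems by (auto simp: orthonormal_on_def)
  ultimately show ?case
    using L2_sq_diff_unit[OF g v[of i], of "a i"] insert gi o[of i i] by simp
qed auto

lemma Bessel_inequality:
  assumes "finite J" "f \<in> L2" "orthonormal_on J v"
  shows "(\<Sum>j\<in>J. (cmod (L2_inner f (v j)))\<^sup>2) \<le> L2_sq f"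
  using L2_sq_diff_orthonormal[OF assms, of "\<lambda>j. L2_inner f (v j)"]
    L2_sq_nonneg[of "\<lambda>x. f x - (\<Sum>j\<in>J. L2_inner f (v j) * v j x)"] by simp

text \<open>Count \<open>\<Sum>\<^sub>i\<Sum>\<^sub>j \<bar>\<langle>e\<^sub>i, v\<^sub>j\<rangle>\<bar>\<^sup>2\<close>, the trace of the product of the two projections, in both orders.\<close>

lemma card_orthonormal_near_span:
  assumes fin: "finite I" "finite J"
    and e: "orthonormal_on I e" and v: "orthonormal_on J v"
    and near: "\<And>i. i \<in> I \<Longrightarrow> \<exists>a. L2_sq (\<lambda>x. e i x - (\<Sum>j\<in>J. a j * v j x)) \<le> d"
  shows "real (card I) * (1 - d) \<le> real (card J)"
proof -
  have unit: "L2_sq (u k) = 1" if "orthonormal_on K u" "k \<in> K" for K and u :: "'c \<Rightarrow> real \<Rightarrow> complex" and k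
    using that L2_inner_self[of "u k"] by (simp add: orthonormal_on_def)
  have "real (card I) * (1 - d) = (\<Sum>i\<in>I. 1 - d)"
    by simp
  also have "\<dots> \<le> (\<Sum>i\<in>I. \<Sum>j\<in>J. (cmod (L2_inner (e i) (v j)))\<^sup>2)"
  proof (rule sum_mono)
    fix i assume i: "i \<in> I"
    then obtain a where a: "L2_sq (\<lambda>x. e i x - (\<Sum>j\<in>J. a j * v j x)) \<le> d"
      using near by blast
    have "e i \<in> L2" using e i by (simp add: orthonormal_on_def)
    \<comment> \<open>Dropping the nonnegative coefficient errors: a unit vector within squared
      distance \<open>d\<close> of the span has a projection of squared norm at least
      \<open>1 - d\<close>.\<close>
    from L2_sq_diff_orthonormal[OF fin(2) this v, of a] a
    show "1 - d \<le> (\<Sum>j\<in>J. (cmod (L2_inner (e i) (v j)))\<^sup>2)"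
      using unit[OF e i] sum_nonneg[of J "\<lambda>j. (cmod (a j - L2_inner (e i) (v j)))\<^sup>2"] by simp
  qed
  also have "\<dots> = (\<Sum>j\<in>J. \<Sum>i\<in>I. (cmod (L2_inner (v j) (e i)))\<^sup>2)"
    by (subst sum.swap) (simp add: L2_inner_commute[of "v _" "e _"])
  also have "\<dots> \<le> (\<Sum>j\<in>J. 1)"
  proof (rule sum_mono)
    fix j assume j: "j \<in> J"
    show "(\<Sum>i\<in>I. (cmod (L2_inner (v j) (e i)))\<^sup>2) \<le> 1"
      using Bessel_inequality[OF fin(1) _ e, of "v j"] unit[OF v j] v j by (simp add: orthonormal_on_def)
  qed
  finally show ?thesis by simp
qed

section \<open>The Gabor family of the unit interval and approximation from its span\<close>

definition gab :: "int \<times> int \<Rightarrow> real \<Rightarrow> complex" where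
  "gab p x = indicat_real {of_int (fst p)..<of_int (fst p) + 1} x *\<^sub>R cis (2 * pi * of_int (snd p) * x)"

lemma cis_measurable [measurable]: "cis \<in> borel_measurable borel"
  by (intro borel_measurable_continuous_onI continuous_intros)

lemma gab_measurable [measurable]: "gab p \<in> borel_measurable borel"
  unfolding gab_def by measurable

lemma gab_L2: "gab p \<in> L2"
proof -
  have eq: "(\<lambda>x. (cmod (gab p x))\<^sup>2) = indicat_real {of_int (fst p)..<of_int (fst p) + 1}"
    by (auto simp: gab_def indicator_def)
  show ?thesis
    by (simp add: L2_def eq integrable_real_indicator)
qed

lemma cis_int_2pi: "cis (2 * pi * of_int n) = 1"
  by (metis cis_multiple_2pi Ints_of_int)

lemma integral_cis_unit_interval:
  fixes n k :: int
  shows "(LINT x|lborel. indicat_real {of_int n..<of_int n + 1} x *\<^sub>R cis (2 * pi * of_int k * x))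
           = (if k = 0 then 1 else 0)"
proof (cases "k = 0")
  case False
  let ?c = "2 * pi * of_int k :: real"
  \<comment> \<open>An antiderivative, available because \<open>k\<close> is nonzero; by periodicity
    it takes equal values at the two integer endpoints.\<close>
  define F where "F x = cis (?c * x) / (\<i> * of_real ?c)" for x
  have "has_bochner_integral lborel
      (\<lambda>x. indicat_real {of_int n..of_int n + 1} x *\<^sub>R cis (?c * x)) (F (of_int n + 1) - F (of_int n))"
  proof (rule has_bochner_integral_FTC_Icc)
    fix x :: real
    show "(F has_vector_derivative cis (?c * x)) (at x within {of_int n..of_int n + 1})"
    proof -
      have "((\<lambda>z. exp (\<i> * of_real ?c * z) / (\<i> * of_real ?c)) has_field_derivative
          exp (\<i> * of_real ?c * of_real x)) (at (of_real x))"
        using False by (auto intro!: derivative_eq_intros)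
      from has_vector_derivative_real_field[OF this] show ?thesis
        by (simp add: F_def[abs_def] cis_conv_exp mult.assoc)
    qed
    show "continuous_on {of_int n..of_int n + 1} (\<lambda>x. cis (?c * x))"
      by (intro continuous_intros)
  qed auto
  moreover have "F (of_int n + 1) = F (of_int n)"
    using cis_int_2pi[of k] by (simp add: F_def distrib_left add: cis_mult[symmetric] del: of_int_mult)
  ultimately have "(LINT x|lborel. indicat_real {of_int n..of_int n + 1} x *\<^sub>R cis (?c * x)) = 0"
    by (simp add: has_bochner_integral_iff)
  \<comment> \<open>The closed and the half-open cell differ in one point, a null set.\<close>
  also have "(LINT x|lborel. indicat_real {of_int n..of_int n + 1} x *\<^sub>R cis (?c * x))
      = (LINT x|lborel. indicat_real {of_int n..<of_int n + 1} x *\<^sub>R cis (?c * x))"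
    by (rule integral_cong_AE)
       (use AE_lborel_singleton[of "of_int n + 1"] in \<open>auto simp: indicator_def elim: eventually_mono\<close>)
  finally show ?thesis using False by simp
qed auto

lemma orthonormal_gab: "orthonormal_on J gab"
proof -
  have "L2_inner (gab p) (gab q) = (if p = q then 1 else 0)" for p q
  proof (cases "fst p = fst q")
    case True
    have "gab p x * cnj (gab q x) = indicat_real {of_int (fst p)..<of_int (fst p) + 1} x *\<^sub>R
        cis (2 * pi * of_int (snd p - snd q) * x)" for x
      by (auto simp: gab_def True indicator_def cis_cnj cis_mult algebra_simps)
    then show ?thesis
      unfolding L2_inner_def using True by (simp only: integral_cis_unit_interval) (auto simp: prod_eq_iff)
  next
    case False
    \<comment> \<open>The cells are disjoint: \<open>x\<close> determines its cell through the
      floor.\<close>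
    have z: "gab p x * cnj (gab q x) = 0" for x
    proof (rule ccontr)
      assume "gab p x * cnj (gab q x) \<noteq> 0"
      then have "\<lfloor>x\<rfloor> = fst p" "\<lfloor>x\<rfloor> = fst q"
        by (auto simp: gab_def indicator_def floor_eq_iff split: if_splits)
      then show False using False by simp
    qed
    then show ?thesis
      unfolding L2_inner_def z using False by auto
  qed
  then show ?thesis
    by (simp add: orthonormal_on_def gab_L2)
qed

text \<open>The number \<open>d\<close> bounds a squared distance. Membership in \<open>L2\<close>
  is included because \<open>L2_sq\<close> takes the default value 0 when the square is not
  integrable.\<close>

definition near_gab :: "(int \<times> int) set \<Rightarrow> real \<Rightarrow> (real \<Rightarrow> complex) \<Rightarrow> bool" where
  "near_gab J d f \<longleftrightarrow> f \<in> L2 \<and> (\<exists>a. L2_sq (\<lambda>x. f x - (\<Sum>p\<in>J. a p * gab p x)) \<le> d)"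

lemma gab_sum_L2: "(\<lambda>x. \<Sum>p\<in>J. a p * gab p x) \<in> L2"
  by (intro L2_sum L2_scale gab_L2)

lemma near_gab_mono:
  assumes "near_gab J d f" "J \<subseteq> J'" "finite J'" "d \<le> d'"
  shows "near_gab J' d' f"
proof -
  obtain a where a: "f \<in> L2" "L2_sq (\<lambda>x. f x - (\<Sum>p\<in>J. a p * gab p x)) \<le> d"
    using assms by (auto simp: near_gab_def)
  have "(\<Sum>p\<in>J'. (if p \<in> J then a p else 0) * gab p x) = (\<Sum>p\<in>J. a p * gab p x)" for x
    using assms by (intro sum.mono_neutral_cong_right) auto
  then have "L2_sq (\<lambda>x. f x - (\<Sum>p\<in>J'. (if p \<in> J then a p else 0) * gab p x)) \<le> d'"
    using a assms by simp
  then show ?thesis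
    unfolding near_gab_def using a by (intro conjI exI[of _ "\<lambda>p. if p \<in> J then a p else 0"])
qed

lemma near_gab_lincomb:
  assumes "near_gab J d f" "near_gab J d' g"
  shows "near_gab J (2 * (cmod c)\<^sup>2 * d + 2 * (cmod c')\<^sup>2 * d') (\<lambda>x. c * f x + c' * g x)"
proof -
  obtain a b where f: "f \<in> L2" "L2_sq (\<lambda>x. f x - (\<Sum>p\<in>J. a p * gab p x)) \<le> d"
    and g: "g \<in> L2" "L2_sq (\<lambda>x. g x - (\<Sum>p\<in>J. b p * gab p x)) \<le> d'"
    using assms by (auto simp: near_gab_def)
  let ?u = "\<lambda>x. f x - (\<Sum>p\<in>J. a p * gab p x)" and ?v = "\<lambda>x. g x - (\<Sum>p\<in>J. b p * gab p x)"
  have uv: "?u \<in> L2" "?v \<in> L2"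
    using f(1) g(1) by (auto intro: L2_diff gab_sum_L2)
  have eq: "c * f x + c' * g x - (\<Sum>p\<in>J. (c * a p + c' * b p) * gab p x) = c * ?u x + c' * ?v x" for x
    by (simp add: sum.distrib sum_distrib_left algebra_simps)
  have "L2_sq (\<lambda>x. c * ?u x + c' * ?v x) \<le> 2 * ((cmod c)\<^sup>2 * L2_sq ?u) + 2 * ((cmod c')\<^sup>2 * L2_sq ?v)"
    using L2_sq_add_le[OF L2_scale[OF uv(1), of c] L2_scale[OF uv(2), of c']]
    by (simp only: L2_sq_scale)
  also have "\<dots> \<le> 2 * ((cmod c)\<^sup>2 * d) + 2 * ((cmod c')\<^sup>2 * d')"
    using f(2) g(2) by (intro add_mono mult_left_mono) auto
  finally have "L2_sq (\<lambda>x. c * f x + c' * g x - (\<Sum>p\<in>J. (c * a p + c' * b p) * gab p x))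
      \<le> 2 * (cmod c)\<^sup>2 * d + 2 * (cmod c')\<^sup>2 * d'"
    by (simp only: eq mult.assoc)
  then show ?thesis
    unfolding near_gab_def using f(1) g(1)
    by (intro conjI exI[of _ "\<lambda>p. c * a p + c' * b p"] L2_add L2_scale)
qed

lemma L2_translate_modulate:
  assumes "f \<in> L2"
  shows "(\<lambda>x. f (x - t) * cis (s * x)) \<in> L2"
proof -
  have [measurable]: "f \<in> borel_measurable borel" using assms by (rule L2_measurable)
  \<comment> \<open>Translation as an affine substitution of slope 1; the modulation has modulus 1
    and disappears.\<close>
  have "integrable lborel (\<lambda>x. (cmod (f (-t + 1 * x)))\<^sup>2)"
    by (rule lborel_integrable_real_affine) (use assms in \<open>auto simp: L2_def\<close>)
  then show ?thesis by (simp add: L2_def norm_mult)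
qed

lemma L2_sq_translate_modulate: "L2_sq (\<lambda>x. f (x - t) * cis (s * x)) = L2_sq f"
  using lborel_integral_real_affine[of 1 "\<lambda>x. (cmod (f x))\<^sup>2" "-t"]
  by (simp add: L2_sq_def norm_mult)

text \<open>Translating the exponential by an integer produces a phase at an integer multiple of
  \<open>2 * pi\<close>, which is 1. Integer time-frequency shifts thus permute the family exactly,
  without phase factors.\<close>

lemma gab_shift:
  "gab p (x - of_int q) * cis (2 * pi * of_int m * x) = gab (fst p + q, snd p + m) x"
proof -
  have "cis (2 * pi * of_int (snd p) * (x - of_int q))
      = cis (2 * pi * of_int (snd p) * x) * cis (2 * pi * of_int (- (snd p * q)))"
    unfolding cis_mult by (simp add: algebra_simps)
  then have "cis (2 * pi * of_int (snd p) * (x - of_int q)) = cis (2 * pi * of_int (snd p) * x)"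
    by (simp only: cis_int_2pi mult_1_right)
  then show ?thesis
    by (auto simp: gab_def indicator_def cis_mult algebra_simps)
qed

lemma near_gab_shift:
  assumes "near_gab J d f"
  shows "near_gab ((\<lambda>p. (fst p + q, snd p + m)) ` J) d
           (\<lambda>x. f (x - of_int q) * cis (2 * pi * of_int m * x))"
proof -
  let ?s = "\<lambda>p :: int \<times> int. (fst p + q, snd p + m)"
  \<comment> \<open>The coefficients are carried along by the inverse shift of the indices.\<close>
  let ?a' = "\<lambda>a p. a (fst p - q, snd p - m)"
  obtain a where a: "f \<in> L2" "L2_sq (\<lambda>x. f x - (\<Sum>p\<in>J. a p * gab p x)) \<le> d"
    using assms by (auto simp: near_gab_def)
  have "(\<Sum>p\<in>?s ` J. ?a' a p * gab p x)
      = (\<Sum>p\<in>J. a p * (gab p (x - of_int q) * cis (2 * pi * of_int m * x)))" for x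
    by (subst sum.reindex) (auto simp: inj_on_def prod_eq_iff gab_shift)
  then have "f (x - of_int q) * cis (2 * pi * of_int m * x) - (\<Sum>p\<in>?s ` J. ?a' a p * gab p x)
      = (f (x - of_int q) - (\<Sum>p\<in>J. a p * gab p (x - of_int q))) * cis (2 * pi * of_int m * x)" for x
    by (simp add: left_diff_distrib sum_distrib_right mult.assoc)
  then have "L2_sq (\<lambda>x. f (x - of_int q) * cis (2 * pi * of_int m * x) - (\<Sum>p\<in>?s ` J. ?a' a p * gab p x)) \<le> d"
    using a L2_sq_translate_modulate[of "\<lambda>x. f x - (\<Sum>p\<in>J. a p * gab p x)"] by simp
  then show ?thesis
    unfolding near_gab_def using a(1) by (intro conjI exI[of _ "?a' a"] L2_translate_modulate)
qed

section \<open>Trigonometric polynomials of period 1\<close>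

inductive trig_poly :: "(real \<Rightarrow> complex) \<Rightarrow> bool" where
  monom: "trig_poly (\<lambda>x. c * cis (2 * pi * of_int k * x))"
| add: "trig_poly u \<Longrightarrow> trig_poly v \<Longrightarrow> trig_poly (\<lambda>x. u x + v x)"

lemma trig_poly_const: "trig_poly (\<lambda>x. c)"
  using trig_poly.monom[of c 0] by simp

lemma trig_poly_mult:
  assumes "trig_poly u" "trig_poly v"
  shows "trig_poly (\<lambda>x. u x * v x)"
  using assms(1)
proof induction
  case (monom c k)
  show ?case using assms(2)
  proof induction
    case (monom c' k')
    have "(\<lambda>x. c * cis (2 * pi * of_int k * x) * (c' * cis (2 * pi * of_int k' * x)))
        = (\<lambda>x. (c * c') * cis (2 * pi * of_int (k + k') * x))"
    proof
      fix x
      have "cis (2 * pi * of_int (k + k') * x) = cis (2 * pi * of_int k * x) * cis (2 * pi * of_int k' * x)"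
        by (simp add: cis_mult algebra_simps)
      then show "c * cis (2 * pi * of_int k * x) * (c' * cis (2 * pi * of_int k' * x))
          = (c * c') * cis (2 * pi * of_int (k + k') * x)"
        by simp
    qed
    then show ?case by (simp only: trig_poly.monom)
  next
    case (add u v)
    from trig_poly.add[OF add.IH] show ?case by (simp only: distrib_left)
  qed
next
  case (add u v)
  from trig_poly.add[OF add.IH] show ?case by (simp only: distrib_right)
qed

lemma trig_poly_real_polynomial:
  fixes p :: "complex \<Rightarrow> real"
  assumes "real_polynomial_function p"
  shows "trig_poly (\<lambda>x. of_real (p (cis (2 * pi * x))))"
  using assms
proof induction
  case (linear f)
  interpret bounded_linear f by fact
  \<comment> \<open>A real-linear functional on the complex plane is fixed by its values at 1 and
    \<open>\<i>\<close>; Euler's formulas turn the resulting cosine and sine into frequencies 1 and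
    -1.\<close>
  have eq: "complex_of_real (f (cis (2 * pi * x)))
      = (of_real (f 1) / 2 - \<i> * of_real (f \<i>) / 2) * cis (2 * pi * of_int 1 * x)
      + (of_real (f 1) / 2 + \<i> * of_real (f \<i>) / 2) * cis (2 * pi * of_int (-1) * x)" for x
  proof -
    have "cis (2 * pi * x) = cos (2 * pi * x) *\<^sub>R 1 + sin (2 * pi * x) *\<^sub>R \<i>"
      by (simp add: complex_eq_iff)
    then have "f (cis (2 * pi * x)) = cos (2 * pi * x) * f 1 + sin (2 * pi * x) * f \<i>"
      by (simp only: add scale real_scaleR_def)
    then show ?thesis
      by (simp only:) (simp add: complex_eq_iff)
  qed
  show ?case unfolding eq by (intro trig_poly.intros)
next
  case (const c)
  show ?case by (rule trig_poly_const)
next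
  case (add f g)
  from trig_poly.add[OF add.IH] show ?case by (simp only: of_real_add)
next
  case (mult f g)
  from trig_poly_mult[OF mult.IH] show ?case by (simp only: of_real_mult)
qed

text \<open>A \<open>polynomial_function\<close> on the plane is polynomial in the real and
  imaginary parts, not just in the complex variable, so negative frequencies occur as well. The
  claim reduces to the two components.\<close>

lemma trig_poly_polynomial:
  fixes g :: "complex \<Rightarrow> complex"
  assumes "polynomial_function g"
  shows "trig_poly (\<lambda>x. g (cis (2 * pi * x)))"
proof -
  have Re: "real_polynomial_function (Re \<circ> g)" and Im: "real_polynomial_function (Im \<circ> g)"
    using assms bounded_linear_Re bounded_linear_Im by (auto simp: polynomial_function_def)
  have "trig_poly (\<lambda>x. of_real (Re (g (cis (2 * pi * x)))) + \<i> * of_real (Im (g (cis (2 * pi * x)))))"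
    using trig_poly_real_polynomial[OF Re] trig_poly_real_polynomial[OF Im]
    unfolding o_def by (intro trig_poly.add trig_poly_mult trig_poly_const)
  then show ?thesis by (simp flip: complex_eq)
qed

section \<open>Completeness of the Gabor family\<close>

definition gab_closure :: "(real \<Rightarrow> complex) \<Rightarrow> bool" where
  "gab_closure f \<longleftrightarrow> (\<forall>d>0. \<exists>J. finite J \<and> near_gab J d f)"

lemma near_gab_add:
  assumes "near_gab J d f" "near_gab J' d' g" "finite J" "finite J'"
  shows "near_gab (J \<union> J') (2 * d + 2 * d') (\<lambda>x. f x + g x)"
  using near_gab_lincomb[of "J \<union> J'" d f d' g 1 1]
    near_gab_mono[OF assms(1), of "J \<union> J'" d] near_gab_mono[OF assms(2), of "J \<union> J'" d'] assms(3,4)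
  by simp

lemma gab_closure_add:
  assumes "gab_closure f" "gab_closure g"
  shows "gab_closure (\<lambda>x. f x + g x)"
  unfolding gab_closure_def
proof (intro allI impI)
  fix d :: real assume "d > 0"
  then obtain J J' where "finite J" "near_gab J (d/4) f" "finite J'" "near_gab J' (d/4) g"
    using assms unfolding gab_closure_def by (meson divide_pos_pos zero_less_numeral)
  then show "\<exists>J. finite J \<and> near_gab J d (\<lambda>x. f x + g x)"
    using near_gab_add[of J "d/4" f J' "d/4" g] by (intro exI[of _ "J \<union> J'"]) auto
qed

lemma near_gab_zero: "near_gab {} 0 (\<lambda>x. 0)"
  by (simp add: near_gab_def L2_zero L2_sq_def)

lemma gab_closure_sum:
  "finite Q \<Longrightarrow> (\<And>q. q \<in> Q \<Longrightarrow> gab_closure (f q)) \<Longrightarrow> gab_closure (\<lambda>x. \<Sum>q\<in>Q. f q x)"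
proof (induction Q rule: finite_induct)
  case empty
  have "near_gab {} d (\<lambda>x. 0)" if "d > 0" for d
    using near_gab_mono[OF near_gab_zero, of "{}" d] that by simp
  then show ?case unfolding gab_closure_def by auto
qed (simp add: gab_closure_add)

lemma gab_closure_limit:
  assumes f: "f \<in> L2" and appr: "\<And>d. d > 0 \<Longrightarrow> \<exists>g. gab_closure g \<and> L2_sq (\<lambda>x. f x - g x) \<le> d"
  shows "gab_closure f"
  unfolding gab_closure_def
proof (intro allI impI)
  fix d :: real assume d: "d > 0"
  then obtain g where g: "gab_closure g" "L2_sq (\<lambda>x. f x - g x) \<le> d / 4"
    using appr[of "d/4"] by auto
  obtain J where J: "finite J" "near_gab J (d/4) g"
    using g(1) d unfolding gab_closure_def by (meson divide_pos_pos zero_less_numeral)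
  \<comment> \<open>The remainder is already small, so the empty sum approximates it. Adding two
    errors \<open>d/4\<close> yields \<open>2 * (d/4) + 2 * (d/4) = d\<close>.\<close>
  have "near_gab {} (d/4) (\<lambda>x. f x - g x)"
    using f g(2) J by (simp add: near_gab_def L2_diff)
  from near_gab_add[OF J(2) this J(1)] show "\<exists>J. finite J \<and> near_gab J d f"
    using J(1) by auto
qed

lemma gab_closure_trig_poly:
  assumes "trig_poly u"
  shows "gab_closure (\<lambda>x. indicat_real {of_int q..<of_int q + 1} x *\<^sub>R u x)"
  using assms
proof induction
  case (monom c k)
  have "near_gab {(q, k)} d (\<lambda>x. indicat_real {of_int q..<of_int q + 1} x *\<^sub>R (c * cis (2 * pi * of_int k * x)))"
    if "d > 0" for d
  proof -
    have eq: "indicat_real {of_int q..<of_int q + 1} x *\<^sub>R (c * cis (2 * pi * of_int k * x)) = c * gab (q, k) x" for x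
      by (simp add: gab_def)
    show ?thesis
      unfolding near_gab_def eq using that
      by (intro conjI L2_scale gab_L2 exI[of _ "\<lambda>_. c"]) (simp add: L2_sq_def)
  qed
  then show ?case unfolding gab_closure_def by blast
next
  case (add u v)
  from gab_closure_add[OF add.IH] show ?case by (simp only: scaleR_add_right)
qed

text \<open>Wrapping one period of \<open>G\<close> around the circle creates a jump at 1. The
  cutoff vanishes there and \<open>G\<close> is bounded, so the product tends to 0; elsewhere the
  argument function is continuous.\<close>

lemma continuous_on_circle_cutoff:
  fixes G :: "real \<Rightarrow> complex"
  assumes G: "continuous_on UNIV G" and B: "\<And>x. cmod (G x) \<le> B" and n: "n \<ge> 0"
  shows "continuous_on (sphere 0 1) (\<lambda>z. of_real (min 1 (n * cmod (z - 1))) * G (q + Arg2pi z / (2 * pi)))"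
    (is "continuous_on _ ?F")
  unfolding continuous_on_eq_continuous_within
proof
  fix z :: complex assume z: "z \<in> sphere 0 1"
  show "continuous (at z within sphere 0 1) ?F"
  proof (cases "z = 1")
    case True
    have "((\<lambda>z. n * cmod (z - 1) * B) \<longlongrightarrow> n * cmod (1 - 1) * B) (at 1 within sphere 0 1)"
      by (intro tendsto_mult tendsto_const tendsto_norm tendsto_diff tendsto_ident_at)
    then have lim: "((\<lambda>z. n * cmod (z - 1) * B) \<longlongrightarrow> 0) (at 1 within sphere 0 1)"
      by simp
    have "norm (?F w) \<le> n * cmod (w - 1) * B" for w
    proof -
      have "norm (?F w) = min 1 (n * cmod (w - 1)) * cmod (G (q + Arg2pi w / (2 * pi)))"
        using n by (simp add: norm_mult)
      also have "\<dots> \<le> n * cmod (w - 1) * B"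
        by (rule mult_mono) (use B n in simp_all)
      finally show ?thesis .
    qed
    then have "(?F \<longlongrightarrow> 0) (at 1 within sphere 0 1)"
      by (intro Lim_null_comparison[OF always_eventually lim]) blast
    then show ?thesis
      by (simp only: continuous_within True) simp
  next
    case False
    \<comment> \<open>The branch cut of \<open>Arg2pi\<close> is the nonnegative real axis, which
      meets the unit circle only at 1.\<close>
    have "z \<notin> \<real>\<^sub>\<ge>\<^sub>0"
    proof
      assume "z \<in> \<real>\<^sub>\<ge>\<^sub>0"
      then obtain r where "z = of_real r" "r \<ge> 0" by (auto simp: nonneg_Reals_def)
      then show False using z False by simp
    qed
    then have "isCont Arg2pi z" by (rule continuous_at_Arg2pi)
    then have A: "isCont (\<lambda>z. q + Arg2pi z / (2 * pi)) z"
      by (intro continuous_add continuous_divide continuous_const) auto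
    have "isCont G (q + Arg2pi z / (2 * pi))"
      using G by (simp add: continuous_on_eq_continuous_at)
    with A have B: "isCont (\<lambda>z. G (q + Arg2pi z / (2 * pi))) z"
      by (rule isCont_o2)
    have C: "isCont (\<lambda>z. complex_of_real (min 1 (n * cmod (z - 1)))) z"
      by (intro continuous_intros)
    from C B have "isCont ?F z"
      by (rule continuous_mult)
    then show ?thesis by (rule continuous_at_imp_continuous_within)
  qed
qed

text \<open>\<open>Arg2pi\<close> takes values from 0 inclusive to \<open>2 * pi\<close> exclusive,
  which matches cells closed on the left and open on the right.\<close>

lemma Arg2pi_cis_unit_interval:
  assumes "of_int q \<le> x" "x < of_int q + 1"
  shows "of_int q + Arg2pi (cis (2 * pi * x)) / (2 * pi) = x"
proof -
  have "cis (2 * pi * x) = cis (2 * pi * (x - of_int q)) * cis (2 * pi * of_int q)"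
    unfolding cis_mult by (simp add: algebra_simps)
  then have "cis (2 * pi * x) = cis (2 * pi * (x - of_int q))"
    by (simp only: cis_int_2pi mult_1_right)
  moreover have "Arg2pi (cis (2 * pi * (x - of_int q))) = 2 * pi * (x - of_int q)"
    using assms by (intro Arg2pi_unique[of 1]) (auto simp: cis_conv_exp)
  ultimately show ?thesis by (simp add: field_simps)
qed

text \<open>Stone-Weierstrass on the circle gives uniform approximation by trigonometric
  polynomials, and on a cell of length 1 the uniform error bounds the \<open>L2\<close>
  error.\<close>

lemma gab_closure_continuous_piece:
  fixes G :: "real \<Rightarrow> complex"
  assumes G: "continuous_on UNIV G" and B: "\<And>x. cmod (G x) \<le> B" and n: "n \<ge> 0"
  shows "gab_closure (\<lambda>x. indicat_real {of_int q..<of_int q + 1} x *\<^sub>R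
           (of_real (min 1 (n * cmod (cis (2 * pi * x) - 1))) * G x))" (is "gab_closure ?f")
proof (rule gab_closure_limit)
  have [measurable]: "G \<in> borel_measurable borel"
    using G by (rule borel_measurable_continuous_onI)
  have meas [measurable]: "?f \<in> borel_measurable borel" by measurable
  have "B \<ge> 0" using B[of 0] norm_ge_zero[of "G 0"] by linarith
  show "?f \<in> L2"
  proof (rule L2_bound[OF L2_scale[OF gab_L2[of "(q, 0)"], of "of_real B"] meas])
    fix x
    show "cmod (?f x) \<le> cmod (of_real B * gab (q, 0) x)"
      using mult_mono[of "\<bar>min 1 (n * cmod (cis (2 * pi * x) - 1))\<bar>" 1 "cmod (G x)" B] B[of x] n \<open>B \<ge> 0\<close>
      by (auto simp: gab_def indicator_def norm_mult)
  qed
  fix d :: real assume d: "d > 0"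
  let ?F = "\<lambda>z. of_real (min 1 (n * cmod (z - 1))) * G (of_int q + Arg2pi z / (2 * pi))"
  \<comment> \<open>A uniform error below \<open>sqrt d\<close> makes the squared norm at most
    \<open>d\<close>.\<close>
  obtain g where g: "polynomial_function g" "\<And>z. z \<in> sphere 0 1 \<Longrightarrow> cmod (?F z - g z) < sqrt d"
    using Stone_Weierstrass_polynomial_function[OF compact_sphere continuous_on_circle_cutoff[OF G B n, of "of_int q"],
        of "sqrt d"] d by auto
  let ?g = "\<lambda>x. indicat_real {of_int q..<of_int q + 1} x *\<^sub>R g (cis (2 * pi * x))"
  have cl: "gab_closure ?g"
    by (intro gab_closure_trig_poly trig_poly_polynomial g)
  have gm: "continuous_on UNIV g"
    using g(1) by (rule continuous_on_polymonial_function)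
  then have [measurable]: "g \<in> borel_measurable borel"
    by (rule borel_measurable_continuous_onI)
  have "L2_sq (\<lambda>x. ?f x - ?g x) \<le> L2_sq (\<lambda>x. of_real (sqrt d) * gab (q, 0) x)"
  proof (rule L2_sq_mono[OF L2_scale[OF gab_L2]])
    show "(\<lambda>x. ?f x - ?g x) \<in> borel_measurable borel" by measurable
    fix x
    show "cmod (?f x - ?g x) \<le> cmod (of_real (sqrt d) * gab (q, 0) x)"
    proof (cases "x \<in> {of_int q..<of_int q + 1}")
      case True
      then show ?thesis
        using g(2)[of "cis (2 * pi * x)"] Arg2pi_cis_unit_interval[of q x] d
        by (simp add: gab_def norm_mult)
    qed (simp add: gab_def)
  qed
  also have "\<dots> = d"
    using d orthonormal_gab[of UNIV] L2_inner_self[of "gab (q, 0)"]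
    by (simp add: L2_sq_scale orthonormal_on_def)
  finally show "\<exists>g. gab_closure g \<and> L2_sq (\<lambda>x. ?f x - g x) \<le> d"
    using cl by blast
qed

lemma L2_sq_dominated_convergence:
  assumes f: "f \<in> borel_measurable borel" and s: "\<And>i. s i \<in> borel_measurable borel" and w: "w \<in> L2"
    and lim: "AE x in lborel. (\<lambda>i. s i x) \<longlonglongrightarrow> f x"
    and dom: "\<And>i x. cmod (f x - s i x) \<le> cmod (w x)"
  shows "(\<lambda>i. L2_sq (\<lambda>x. f x - s i x)) \<longlonglongrightarrow> 0"
proof -
  note [measurable] = f s
  have "(\<lambda>i. LINT x|lborel. (cmod (f x - s i x))\<^sup>2) \<longlonglongrightarrow> (LINT (x :: real)|lborel. (0 :: real))"
  proof (rule integral_dominated_convergence[where w = "\<lambda>x. (cmod (w x))\<^sup>2"])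
    show "AE x in lborel. (\<lambda>i. (cmod (f x - s i x))\<^sup>2) \<longlonglongrightarrow> 0"
      using lim
    proof eventually_elim
      case (elim x)
      have "(\<lambda>i. (cmod (f x - s i x))\<^sup>2) \<longlonglongrightarrow> (cmod (f x - f x))\<^sup>2"
        by (intro tendsto_intros elim)
      then show ?case by simp
    qed
    show "AE x in lborel. norm ((cmod (f x - s i x))\<^sup>2) \<le> (cmod (w x))\<^sup>2" for i
      using dom by (simp add: power_mono)
  qed (use L2_integrable_sq[OF w] in auto)
  then show ?thesis by (simp add: L2_sq_def)
qed

lemma gab_closure_tendsto:
  assumes "f \<in> L2" "\<And>i. gab_closure (s i)" "(\<lambda>i. L2_sq (\<lambda>x. f x - s i x)) \<longlonglongrightarrow> 0"
  shows "gab_closure f"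
proof (rule gab_closure_limit[OF assms(1)])
  fix d :: real assume "d > 0"
  then have "eventually (\<lambda>i. L2_sq (\<lambda>x. f x - s i x) < d) sequentially"
    by (rule order_tendstoD(2)[OF assms(3)])
  then obtain i where "L2_sq (\<lambda>x. f x - s i x) < d"
    by (auto simp: eventually_sequentially)
  then show "\<exists>g. gab_closure g \<and> L2_sq (\<lambda>x. f x - g x) \<le> d"
    using assms(2)[of i] by (intro exI[of _ "s i"]) simp
qed

text \<open>Exactly one cell contains \<open>x\<close>, the one indexed by its floor.\<close>

lemma sum_indicat_unit_intervals:
  fixes x :: real
  shows "(\<Sum>q\<in>{- int n..<int n}. indicat_real {of_int q..<of_int q + 1} x) = indicat_real {- real n..<real n} x"
proof -
  have "indicat_real {of_int q..<of_int q + 1} x = (if q = \<lfloor>x\<rfloor> then 1 else 0)" for q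
    by (auto simp: indicator_def floor_unique)
  moreover have "- int n \<le> \<lfloor>x\<rfloor> \<and> \<lfloor>x\<rfloor> < int n \<longleftrightarrow> x \<in> {- real n..<real n}"
    by (simp add: le_floor_iff floor_less_iff)
  ultimately show ?thesis by (simp add: indicator_def)
qed

lemma L2_bounded_support:
  assumes f: "f \<in> borel_measurable borel" and "B \<ge> 0"
    and B: "\<And>x. cmod (f x) \<le> B * indicat_real {- real n..<real n} x"
  shows "f \<in> L2" "(\<lambda>x. of_real (B * indicat_real {- real n..<real n} x)) \<in> L2"
proof -
  have "(\<lambda>x. (cmod (of_real (B * indicat_real {- real n..<real n} x)))\<^sup>2)
      = (\<lambda>x. B\<^sup>2 * indicat_real {- real n..<real n} x)"
    by (auto simp: indicator_def)
  then show *: "(\<lambda>x. of_real (B * indicat_real {- real n..<real n} x)) \<in> L2"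
    unfolding L2_def by (auto intro!: integrable_real_indicator)
  show "f \<in> L2"
  proof (rule L2_bound[OF * f])
    fix x
    show "cmod (f x) \<le> cmod (of_real (B * indicat_real {- real n..<real n} x))"
      using B[of x] \<open>B \<ge> 0\<close> unfolding norm_of_real by simp
  qed
qed

text \<open>The cutoff factor makes the approximants vanish at the integers, so that each unit interval
  closes up to a circle.\<close>

lemma gab_closure_bounded:
  assumes f [measurable]: "f \<in> borel_measurable borel" and B0: "B \<ge> 0"
    and B: "\<And>x. cmod (f x) \<le> B * indicat_real {- real n..<real n} x"
  shows "gab_closure f"
proof -
  have fB: "cmod (f x) \<le> B" for x
    using B[of x] B0 by (cases "x \<in> {- real n..<real n}") auto
  have f0: "f x = 0" if "x \<notin> {- real n..<real n}" for x
    using B[of x] that by simp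
  \<comment> \<open>Measurability is traded for \<open>measurable_on\<close>, which provides
    continuous functions on the whole line converging to \<open>f\<close> off a negligible
    set.\<close>
  have "f \<in> borel_measurable (lebesgue_on UNIV)"
    unfolding lebesgue_on_UNIV_eq using f by (intro measurable_completion) simp
  then have "f measurable_on UNIV"
    by (subst measurable_on_iff_borel_measurable) auto
  then obtain Z g where Z: "negligible Z" and g: "\<And>i. continuous_on UNIV (g i)"
    and gf: "\<And>x. x \<notin> Z \<Longrightarrow> (\<lambda>i. g i x) \<longlonglongrightarrow> f x"
    unfolding measurable_on_def by auto
  \<comment> \<open>Projecting onto the disc of radius \<open>B\<close> bounds the approximants
    uniformly, keeps them continuous, and fixes the limit because \<open>f\<close> takes values in
    that disc.\<close>
  let ?P = "closest_point (cball (0 :: complex) B)"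
  have P_cont: "continuous_on t ?P" for t
    using B0 by (intro continuous_on_closest_point) auto
  have P_le: "cmod (?P z) \<le> B" for z
    using closest_point_in_set[of "cball 0 B" z] B0 by simp
  define G where "G i x = ?P (g i x)" for i x
  have G_cont: "continuous_on UNIV (G i)" for i
    unfolding G_def by (rule continuous_on_compose2[OF P_cont g]) auto
  then have [measurable]: "G i \<in> borel_measurable borel" for i
    by (rule borel_measurable_continuous_onI)
  \<comment> \<open>The slope of the cutoff grows with \<open>i\<close>, so the cutoff tends to 1
    away from the integers.\<close>
  define h where "h i x = of_real (min 1 (real i * cmod (cis (2 * pi * x) - 1))) * G i x" for i x
  have [measurable]: "h i \<in> borel_measurable borel" for i
    unfolding h_def by measurable
  have h_le: "cmod (h i x) \<le> B" for i x
    using mult_mono[of "min 1 (real i * cmod (cis (2 * pi * x) - 1))" 1 "cmod (G i x)" B] P_le[of "g i x"]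
    by (simp add: h_def norm_mult G_def)
  define s where "s i x = indicat_real {- real n..<real n} x *\<^sub>R h i x" for i x
  have s_eq: "s i = (\<lambda>x. \<Sum>q\<in>{- int n..<int n}. indicat_real {of_int q..<of_int q + 1} x *\<^sub>R h i x)" for i
    unfolding s_def by (simp only: sum_indicat_unit_intervals[symmetric] scaleR_left.sum)
  have s_closure: "gab_closure (s i)" for i
    unfolding s_eq h_def
    by (intro gab_closure_sum gab_closure_continuous_piece[where B = B]) (auto simp: G_def P_le g intro: G_cont[unfolded G_def])
  have conv: "(\<lambda>i. s i x) \<longlonglongrightarrow> f x" if x: "x \<notin> Z" "x \<notin> \<int>" for x
  proof -
    have "isCont ?P (f x)"
      using P_cont[of UNIV] by (simp add: continuous_on_eq_continuous_at)
    from isCont_tendsto_compose[OF this gf[OF x(1)]]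
    have G_lim: "(\<lambda>i. G i x) \<longlonglongrightarrow> f x"
      using fB[of x] by (simp add: G_def closest_point_self)
    have c: "cmod (cis (2 * pi * x) - 1) > 0"
    proof (rule ccontr)
      assume "\<not> cmod (cis (2 * pi * x) - 1) > 0"
      then have "cos (2 * pi * x) = 1" by (simp add: complex_eq_iff)
      then obtain k :: int where "2 * pi * x = of_int k * 2 * pi"
        using cos_one_2pi_int[of "2 * pi * x"] by auto
      then show False using x(2) by simp
    qed
    \<comment> \<open>For a fixed non-integer \<open>x\<close> the cutoff equals 1 as soon as
      \<open>i\<close> reaches the reciprocal of the distance from \<open>cis (2 * pi * x)\<close>
      to 1.\<close>
    have "eventually (\<lambda>i. s i x = indicat_real {- real n..<real n} x *\<^sub>R G i x) sequentially"
      using eventually_ge_at_top[of "nat \<lceil>1 / cmod (cis (2 * pi * x) - 1)\<rceil>"]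
    proof eventually_elim
      case (elim i)
      then have "1 / cmod (cis (2 * pi * x) - 1) \<le> real i" by linarith
      then have "1 \<le> real i * cmod (cis (2 * pi * x) - 1)"
        using c by (simp add: pos_divide_le_eq)
      then show ?case by (simp add: s_def h_def)
    qed
    moreover have "(\<lambda>i. indicat_real {- real n..<real n} x *\<^sub>R G i x) \<longlonglongrightarrow> f x"
      using G_lim f0[of x] by (cases "x \<in> {- real n..<real n}") auto
    ultimately show ?thesis
      using tendsto_cong[of "\<lambda>i. s i x" "\<lambda>i. indicat_real {- real n..<real n} x *\<^sub>R G i x" sequentially "f x"] by simp
  qed
  have "AE x in lborel. x \<notin> \<int>"
    by (rule AE_not_in) (simp add: countable_imp_null_set_lborel countable_int)
  moreover have "AE x in lborel. x \<notin> Z"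
    using AE_not_in[of Z lebesgue] Z by (simp only: negligible_iff_null_sets AE_completion_iff)
  ultimately have "AE x in lborel. (\<lambda>i. s i x) \<longlonglongrightarrow> f x"
    by eventually_elim (rule conv)
  moreover have "cmod (f x - s i x) \<le> cmod (of_real (2 * B * indicat_real {- real n..<real n} x))" for i x
  proof (cases "x \<in> {- real n..<real n}")
    case True
    then show ?thesis
      using norm_triangle_ineq4[of "f x" "s i x"] fB[of x] h_le[of i x] B0 by (simp add: s_def)
  qed (simp add: f0 s_def)
  moreover have "(\<lambda>x. of_real (2 * B * indicat_real {- real n..<real n} x)) \<in> L2"
    by (rule L2_bounded_support(2)[of "\<lambda>_. 0"]) (use B0 in auto)
  moreover have "s i \<in> borel_measurable borel" for i
    unfolding s_def by measurable
  ultimately have "(\<lambda>i. L2_sq (\<lambda>x. f x - s i x)) \<longlonglongrightarrow> 0"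
    by (intro L2_sq_dominated_convergence[OF f])
  then show ?thesis
    by (rule gab_closure_tendsto[OF L2_bounded_support(1)[OF f B0 B] s_closure])
qed

text \<open>Truncation in height and in support reduces to the bounded case. At each point the
  truncation is eventually inactive, and \<open>f\<close> itself dominates the error.\<close>

lemma L2_gab_closure:
  assumes f: "f \<in> L2"
  shows "gab_closure f"
proof -
  have [measurable]: "f \<in> borel_measurable borel" using f by (rule L2_measurable)
  define s where "s i x = (if cmod (f x) \<le> real i \<and> x \<in> {- real i..<real i} then f x else 0)" for i x
  have [measurable]: "s i \<in> borel_measurable borel" for i
    unfolding s_def by measurable
  have cl: "gab_closure (s i)" for i
    by (rule gab_closure_bounded[where B = "real i" and n = i]) (auto simp: s_def)
  have "(\<lambda>i. s i x) \<longlonglongrightarrow> f x" for x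
  proof (rule tendsto_eventually)
    show "eventually (\<lambda>i. s i x = f x) sequentially"
      using eventually_ge_at_top[of "nat \<lceil>cmod (f x)\<rceil> + nat \<lceil>\<bar>x\<bar>\<rceil> + 1"]
    proof eventually_elim
      case (elim i)
      then have "cmod (f x) \<le> real i" "\<bar>x\<bar> < real i" by linarith+
      then show ?case by (auto simp: s_def)
    qed
  qed
  then have "(\<lambda>i. L2_sq (\<lambda>x. f x - s i x)) \<longlonglongrightarrow> 0"
    by (intro L2_sq_dominated_convergence[where w = f] f) (auto simp: s_def)
  then show ?thesis
    by (rule gab_closure_tendsto[OF f cl])
qed

section \<open>Localizing the Wilson functions in a box and counting\<close>

lemma uniform_box_approximation:
  assumes \<phi>: "\<phi> \<in> L2" and d: "d > 0"
  shows "\<exists>K :: nat. \<forall>r \<in> {0..<N :: int}.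
           near_gab ({- int K..int K} \<times> {- int K..int K}) d (\<lambda>x. \<phi> (x - \<beta> * of_int r))"
proof -
  have "gab_closure (\<lambda>x. \<phi> (x - \<beta> * of_int r))" for r
    using L2_gab_closure[OF L2_translate_modulate[OF \<phi>, of _ 0]] by simp
  then have "\<forall>r. \<exists>J. finite J \<and> near_gab J d (\<lambda>x. \<phi> (x - \<beta> * of_int r))"
    using d by (auto simp: gab_closure_def)
  then obtain J where J: "\<And>r. finite (J r)" "\<And>r. near_gab (J r) d (\<lambda>x. \<phi> (x - \<beta> * of_int r))"
    by metis
  \<comment> \<open>Only finitely many fractional shifts \<open>r\<close> occur, so their finite
    index sets fit into one common square.\<close>
  have fin: "finite ((\<lambda>p. nat (max \<bar>fst p\<bar> \<bar>snd p\<bar>)) ` (\<Union>r\<in>{0..<N}. J r))"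
    using J(1) by simp
  then obtain K where K: "\<And>k. k \<in> (\<lambda>p. nat (max \<bar>fst p\<bar> \<bar>snd p\<bar>)) ` (\<Union>r\<in>{0..<N}. J r) \<Longrightarrow> k \<le> K"
    by (meson finite_nat_set_iff_bounded_le)
  have "J r \<subseteq> {- int K..int K} \<times> {- int K..int K}" if "r \<in> {0..<N}" for r
  proof
    fix p assume "p \<in> J r"
    then have "nat (max \<bar>fst p\<bar> \<bar>snd p\<bar>) \<le> K"
      using that by (intro K imageI) auto
    then show "p \<in> {- int K..int K} \<times> {- int K..int K}"
      by (cases p) auto
  qed
  then show ?thesis
    using J(2) by (intro exI[of _ K] ballI near_gab_mono[OF J(2)]) auto
qed

text \<open>Division of \<open>j\<close> by \<open>N\<close> splits the translation into an integer
  and one of \<open>N\<close> fractional shifts. The fractional part is covered by the common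
  square, and the integer part, together with the modulation, merely moves that square.\<close>

lemma near_gab_tf_shift:
  assumes near: "\<forall>r \<in> {0..<int N}.
      near_gab ({- int K..int K} \<times> {- int K..int K}) d (\<lambda>x. \<phi> (x - \<beta> * of_int r))"
    and \<beta>: "\<beta> * real N = 1" and N: "N > 0"
    and j: "0 \<le> j" "j < int (N * R)" and m: "\<bar>m\<bar> \<le> int M"
  shows "near_gab ({- int K..int (R + K)} \<times> {- int (M + K)..int (M + K)}) d (tf_shift \<phi> 1 \<beta> j m)"
proof -
  let ?q = "j div int N" and ?r = "j mod int N"
  have "?q * int N \<le> j"
    using div_mult_mod_eq[of j "int N"] pos_mod_sign[of "int N" j] N by linarith
  then have "?q * int N < int R * int N"
    using j(2) by (simp add: mult.commute)
  then have q: "0 \<le> ?q" "?q < int R"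
    using j(1) N by (simp_all add: pos_imp_zdiv_nonneg_iff)
  have "?r \<in> {0..<int N}" using N by simp
  with near have "near_gab ({- int K..int K} \<times> {- int K..int K}) d (\<lambda>x. \<phi> (x - \<beta> * of_int ?r))"
    by blast
  from near_gab_shift[OF this, of ?q m]
  have "near_gab ((\<lambda>p. (fst p + ?q, snd p + m)) ` ({- int K..int K} \<times> {- int K..int K})) d
      (\<lambda>x. \<phi> (x - of_int ?q - \<beta> * of_int ?r) * cis (2 * pi * of_int m * x))" .
  moreover have "x - of_int ?q - \<beta> * of_int ?r = x - \<beta> * of_int j" for x
  proof -
    have "real_of_int j = of_int (?q * int N + ?r)" by simp
    also have "\<dots> = of_int ?q * real N + of_int ?r"
      by (simp only: of_int_add of_int_mult of_int_of_nat_eq)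
    finally have "\<beta> * of_int j = (\<beta> * real N) * of_int ?q + \<beta> * of_int ?r"
      by (simp add: algebra_simps)
    then show ?thesis unfolding \<beta> by simp
  qed
  ultimately have "near_gab ((\<lambda>p. (fst p + ?q, snd p + m)) ` ({- int K..int K} \<times> {- int K..int K})) d
      (tf_shift \<phi> 1 \<beta> j m)"
    by (simp add: tf_shift_def[abs_def])
  then show ?thesis
    by (rule near_gab_mono) (use q m in auto)
qed

text \<open>Both coefficients have squared modulus \<open>\<beta>\<close>, so the error is at most
  \<open>2 * \<beta> * d + 2 * \<beta> * d\<close>.\<close>

lemma near_gab_wilson_system:
  assumes "\<beta> > 0" "m > 0"
    and "near_gab J d (tf_shift \<phi> \<alpha> \<beta> j (int m))" "near_gab J d (tf_shift \<phi> \<alpha> \<beta> j (- int m))"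
  shows "near_gab J (4 * \<beta> * d) (wilson_system \<phi> \<alpha> \<beta> (j, m))"
proof -
  let ?c = "of_real (sqrt \<beta>) * cis (- (2 * pi * \<beta> * of_int j * \<alpha> * of_nat m))"
  let ?c' = "of_real (sqrt \<beta>) * ((- 1) powi (j + int m) * cis (2 * pi * \<beta> * of_int j * \<alpha> * of_nat m))"
  have "wilson_system \<phi> \<alpha> \<beta> (j, m)
      = (\<lambda>x. ?c * tf_shift \<phi> \<alpha> \<beta> j (int m) x + ?c' * tf_shift \<phi> \<alpha> \<beta> j (- int m) x)"
    using assms(2) by (simp add: wilson_system_def distrib_left mult.assoc)
  moreover have "(cmod ?c)\<^sup>2 = \<beta>" "(cmod ?c')\<^sup>2 = \<beta>"
    using assms(1) by (simp_all add: norm_mult norm_power_int)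
  ultimately show ?thesis
    using near_gab_lincomb[OF assms(3,4), of ?c ?c'] by (simp add: mult.assoc)
qed

theorem theorem1p5:
  fixes \<beta> :: real
  assumes "\<beta> > 0" and "1 / \<beta> \<in> \<nat>" and "1 / \<beta> \<ge> 3"
  shows "\<not> (\<exists>\<phi> \<phi>h :: real \<Rightarrow> complex.
           \<phi> \<in> L2 \<and> fourier_L2 \<phi> \<phi>h \<and>
           (compactly_supported \<phi>h \<or> (exponential_decay \<phi> \<and> exponential_decay \<phi>h)) \<and>
           orthonormal_basis_L2 (wilson_system \<phi> 1 \<beta>))"
proof
  assume "\<exists>\<phi> \<phi>h :: real \<Rightarrow> complex.
           \<phi> \<in> L2 \<and> fourier_L2 \<phi> \<phi>h \<and>
           (compactly_supported \<phi>h \<or> (exponential_decay \<phi> \<and> exponential_decay \<phi>h)) \<and>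
           orthonormal_basis_L2 (wilson_system \<phi> 1 \<beta>)"
  then obtain \<phi> where \<phi>: "\<phi> \<in> L2" and onb: "orthonormal_basis_L2 (wilson_system \<phi> 1 \<beta>)"
    by blast
  obtain N where N: "1 / \<beta> = real N"
    using assms(2) by (auto elim: Nats_cases)
  have \<beta>N: "\<beta> * real N = 1"
    using assms(1) by (simp flip: N)
  have N3: "N \<ge> 3"
    using assms(3) unfolding N by simp
  \<comment> \<open>With error 1/16 for the shifts of \<open>\<phi>\<close>, the error
    \<open>4 * \<beta> * d\<close> for the Wilson functions becomes
    \<open>\<beta> / 4\<close>.\<close>
  obtain K where K: "\<forall>r \<in> {0..<int N}.
      near_gab ({- int K..int K} \<times> {- int K..int K}) (1 / 16) (\<lambda>x. \<phi> (x - \<beta> * of_int r))"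
    using uniform_box_approximation[OF \<phi>, of "1/16" "int N" \<beta>] by auto
  \<comment> \<open>The widening \<open>2 * K + 1\<close> of either side of the box is one eighth of
    \<open>M\<close>, small enough for the numerical comparison at the end.\<close>
  define M where "M = 8 * (2 * K + 1)"
  \<comment> \<open>The translations \<open>\<beta> * j\<close> run through the interval from 0 to
    \<open>M\<close>, and the modulations are \<open>m\<close> and \<open>-m\<close> with
    \<open>m\<close> at most \<open>M\<close>. Hence the box has area about \<open>2 * M^2\<close>,
    against \<open>N * M^2\<close> Wilson functions.\<close>
  let ?I = "{0..<int (N * M)} \<times> {1..M}"
  let ?J = "{- int K..int (M + K)} \<times> {- int (M + K)..int (M + K)}"
  have "real (card ?I) * (1 - \<beta> / 4) \<le> real (card ?J)"
  proof (rule card_orthonormal_near_span)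
    show "orthonormal_on ?I (wilson_system \<phi> 1 \<beta>)"
      using onb unfolding orthonormal_basis_L2_def orthonormal_on_def by blast
    show "orthonormal_on ?J gab"
      by (rule orthonormal_gab)
    fix i assume "i \<in> ?I"
    then obtain j m where i: "i = (j, m)" "0 \<le> j" "j < int (N * M)" "0 < m" "m \<le> M"
      by auto
    have tf: "near_gab ?J (1 / 16) (tf_shift \<phi> 1 \<beta> j k)" if "\<bar>k\<bar> \<le> int M" for k
      using near_gab_tf_shift[OF K \<beta>N _ i(2,3) that] N3 by simp
    from near_gab_wilson_system[OF assms(1) i(4) tf tf]
    have "near_gab ?J (\<beta> / 4) (wilson_system \<phi> 1 \<beta> i)"
      using i by simp
    then show "\<exists>a. L2_sq (\<lambda>x. wilson_system \<phi> 1 \<beta> i x - (\<Sum>p\<in>?J. a p * gab p x)) \<le> \<beta> / 4"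
      by (simp add: near_gab_def)
  qed auto
  moreover have "real (card ?I) = real N * (real M)\<^sup>2"
    by (simp add: card_cartesian_product power2_eq_square)
  moreover have "real (card ?J) = (real M + (2 * real K + 1)) * (2 * real M + (2 * real K + 1))"
    by (simp add: card_cartesian_product algebra_simps)
  \<comment> \<open>Since \<open>\<beta> * N = 1\<close>, the total loss is only a quarter of
    \<open>M^2\<close>, whatever the value of \<open>N\<close>.\<close>
  moreover have "real N * (real M)\<^sup>2 * (1 - \<beta> / 4) = (real N - 1 / 4) * (real M)\<^sup>2"
    using \<beta>N by (simp add: algebra_simps)
  ultimately have *: "(real N - 1 / 4) * (real M)\<^sup>2
      \<le> (real M + (2 * real K + 1)) * (2 * real M + (2 * real K + 1))"
    by (simp only:)
  define c where "c = 2 * real K + 1"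
  have c: "c > 0" "real M = 8 * c"
    by (auto simp: c_def M_def)
  \<comment> \<open>As \<open>N\<close> is at least 3, \<open>N - 1/4\<close> is at least 11/4.
    Substituting \<open>M = 8 * c\<close> gives \<open>11/4 * 64 = 176\<close> on the left and
    \<open>9 * 17 = 153\<close> on the right, in units of \<open>c^2\<close>.\<close>
  have "11 / 4 * (real M)\<^sup>2 \<le> (real N - 1 / 4) * (real M)\<^sup>2"
    using N3 by (intro mult_right_mono) auto
  also note *
  finally have "176 * c\<^sup>2 \<le> 153 * c\<^sup>2"
    unfolding c(2) c_def[symmetric] by (simp add: power2_eq_square)
  then show False using c(1) by simp
qed

end
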